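(* Let $X$ be a chain. Then $\mathcal{PO}(X)$ and $\mathcal{POP}(X)$ are regular monoids.
   Context: $X$ is a chain (totally ordered set), finite or infinite. $\mathcal{PT}(X)$ is the monoid of all partial transformations of $X$ (partial maps from $X$ to $X$, including the empty one) under composition of partial maps, written on the right: $x(\alpha\beta)=(x\alpha)\beta$, with $\mathrm{Dom}(\alpha\beta)=\{x\in\mathrm{Dom}(\alpha)\mid x\alpha\in\mathrm{Dom}(\beta)\}$. $\alpha\in\mathcal{PT}(X)$ is order-preserving on $Y\subseteq\mathrm{Dom}(\alpha)$ if $x\le y$ implies $x\alpha\le y\alpha$ for all $x,y\in Y$, and order-preserving if it is so on $\mathrm{Dom}(\alpha)$. $\alpha\in\mathcal{PT}(X)$ is orientation-preserving if it is the empty transformation or there exists a non-empty subset $Y$ of $\mathrm{Dom}(\alpha)$ such that: (OP1) $\alpha$ is order-preserving both on $Y$ and on $\mathrm{Dom}(\alpha)\setminus Y$; (OP2) for all $a\in Y$ and $b\in\mathrm{Dom}(\alpha)\setminus Y$, $a\le b$ and $a\alpha\ge b\alpha$. $\mathcal{PO}(X)$ is the set of all order-preserving, and $\mathcal{POP}(X)$ the set of all orientation-preserving, elements of $\mathcal{PT}(X)$; both are submonoids of $\mathcal{PT}(X)$. A monoid $S$ is regular if for every $\alpha\in S$ there is $\beta\in S$ with $\alpha=\alpha\beta\alpha$. *)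

theory Defs
  imports "HOL-Algebra.Group"
begin

text \<open>
  A chain is a subset \<open>X\<close> of a linearly ordered type, with the induced order; \<open>X\<close> may be
  empty, finite, infinite, or the whole type.  Partial transformations of \<open>X\<close> are maps
  \<open>'a \<rightharpoonup> 'a\<close> whose domain and range lie in \<open>X\<close>.
\<close>

text \<open>
  Maps act on the right, so the product of \<open>\<alpha>\<close> and \<open>\<beta>\<close> applies \<open>\<alpha>\<close> first.
\<close>
definition PT :: "'a set \<Rightarrow> ('a \<rightharpoonup> 'a) monoid" where
  "PT X = \<lparr>carrier = {\<alpha>. dom \<alpha> \<subseteq> X \<and> ran \<alpha> \<subseteq> X},
           mult = (\<lambda>\<alpha> \<beta>. \<beta> \<circ>\<^sub>m \<alpha>),
           one = Some |` X\<rparr>"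

text \<open>
  The conjunct \<open>Y \<subseteq> dom \<alpha>\<close> is needed because \<open>the\<close> is unspecified on \<open>None\<close>.
\<close>
definition order_preserving_on :: "'a::linorder set \<Rightarrow> ('a \<rightharpoonup> 'a) \<Rightarrow> bool" where
  "order_preserving_on Y \<alpha> \<longleftrightarrow>
     Y \<subseteq> dom \<alpha> \<and> (\<forall>x\<in>Y. \<forall>y\<in>Y. x \<le> y \<longrightarrow> the (\<alpha> x) \<le> the (\<alpha> y))"

definition order_preserving :: "('a::linorder \<rightharpoonup> 'a) \<Rightarrow> bool" where
  "order_preserving \<alpha> \<longleftrightarrow> order_preserving_on (dom \<alpha>) \<alpha>"

definition orientation_preserving :: "('a::linorder \<rightharpoonup> 'a) \<Rightarrow> bool" where
  "orientation_preserving \<alpha> \<longleftrightarrow>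
     \<alpha> = Map.empty \<or>
     (\<exists>Y. Y \<noteq> {} \<and> Y \<subseteq> dom \<alpha> \<and>
          order_preserving_on Y \<alpha> \<and> order_preserving_on (dom \<alpha> - Y) \<alpha> \<and>
          (\<forall>a\<in>Y. \<forall>b\<in>dom \<alpha> - Y. a \<le> b \<and> the (\<alpha> a) \<ge> the (\<alpha> b)))"

definition PO :: "'a::linorder set \<Rightarrow> ('a \<rightharpoonup> 'a) monoid" where
  "PO X = (PT X)\<lparr>carrier := {\<alpha> \<in> carrier (PT X). order_preserving \<alpha>}\<rparr>"

definition POP :: "'a::linorder set \<Rightarrow> ('a \<rightharpoonup> 'a) monoid" where
  "POP X = (PT X)\<lparr>carrier := {\<alpha> \<in> carrier (PT X). orientation_preserving \<alpha>}\<rparr>"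

locale regular_monoid = monoid S for S (structure) +
  assumes regular: "\<alpha> \<in> carrier S \<Longrightarrow> \<exists>\<beta>\<in>carrier S. \<alpha> = \<alpha> \<otimes> \<beta> \<otimes> \<alpha>"

end

theory Submission
  imports Defs
begin

text \<open>
  An orientation-preserving map is one whose domain splits into a lower part \<open>Y\<close> and an upper
  part such that the map is monotone on each part and exchanges them: the lower part is mapped
  above the upper part.  If empty parts are admitted, the empty map needs no separate clause,
  and an order-preserving map is one for which the trivial cut \<open>Y = UNIV\<close> works.  So the notion
  to study is a cut \<open>Y\<close> for a map (\<open>orientation_cut\<close> below), and two facts suffice.

  Composition (\<open>comp_orientation_cut\<close>).  Let \<open>Y\<close> be a cut for \<open>\<alpha>\<close> and \<open>U\<close> a cut for \<open>\<beta>\<close>.  They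
  divide the domain of the composite into four blocks, according to whether a point lies in \<open>Y\<close>
  and whether its image lies in \<open>U\<close>.  The blocks \<open>(Y, U)\<close> and \<open>(-Y, -U)\<close> cannot both be
  inhabited, since \<open>\<alpha>\<close> sends \<open>-Y\<close> below \<open>Y\<close> while \<open>U\<close> lies strictly below \<open>-U\<close>.  The
  remaining three blocks form a chain of intervals, and the values descend at only one of the
  two borders between them; that border is a cut for the composite.

  Regularity (\<open>inverse_orientation_cut\<close>).  A map \<open>\<beta>\<close> that sends every value of \<open>\<alpha>\<close> to one of
  its preimages satisfies \<open>\<alpha>\<beta>\<alpha> = \<alpha>\<close>.  The images of the two parts of \<open>\<alpha>\<close> can share a value,
  so \<open>\<beta>\<close> is made to prefer preimages in \<open>Y\<close>.  Then the values attained only outside \<open>Y\<close> form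
  the lower part of a cut for \<open>\<beta>\<close>.  For \<open>Y = UNIV\<close> there are no such values, which gives the
  order-preserving case.
\<close>

section \<open>Cuts of partial maps\<close>

text \<open>
  The set \<open>Y\<close> need not lie in the domain of \<open>\<alpha>\<close>; only its trace there matters.  So the one cut
  \<open>UNIV\<close> serves all order-preserving maps, and the cuts constructed below need not be intersected
  with domains.
\<close>
definition orientation_cut :: "'a::linorder set \<Rightarrow> ('a \<rightharpoonup> 'a) \<Rightarrow> bool" where
  "orientation_cut Y \<alpha> \<longleftrightarrow>
     (\<forall>x y u v. \<alpha> x = Some u \<longrightarrow> \<alpha> y = Some v \<longrightarrow>
        (x \<in> Y \<longrightarrow> y \<notin> Y \<longrightarrow> x \<le> y \<and> v \<le> u) \<and>
        ((x \<in> Y \<longleftrightarrow> y \<in> Y) \<longrightarrow> x \<le> y \<longrightarrow> u \<le> v))"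

lemma orientation_cutI:
  assumes "\<And>x y u v. \<lbrakk>\<alpha> x = Some u; \<alpha> y = Some v; x \<in> Y; y \<notin> Y\<rbrakk> \<Longrightarrow> x \<le> y \<and> v \<le> u"
    and "\<And>x y u v. \<lbrakk>\<alpha> x = Some u; \<alpha> y = Some v; x \<in> Y \<longleftrightarrow> y \<in> Y; x \<le> y\<rbrakk> \<Longrightarrow> u \<le> v"
  shows "orientation_cut Y \<alpha>"
  using assms unfolding orientation_cut_def by blast

lemma orientation_cut_across:
  assumes "orientation_cut Y \<alpha>" "\<alpha> x = Some u" "\<alpha> y = Some v" "x \<in> Y" "y \<notin> Y"
  shows "x \<le> y" "v \<le> u"
  using assms unfolding orientation_cut_def by blast+

lemma orientation_cut_within:
  assumes "orientation_cut Y \<alpha>" "\<alpha> x = Some u" "\<alpha> y = Some v" "x \<in> Y \<longleftrightarrow> y \<in> Y" "x \<le> y"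
  shows "u \<le> v"
  using assms unfolding orientation_cut_def by blast

lemma order_preserving_iff:
  "order_preserving \<alpha> \<longleftrightarrow> (\<forall>x y u v. \<alpha> x = Some u \<longrightarrow> \<alpha> y = Some v \<longrightarrow> x \<le> y \<longrightarrow> u \<le> v)"
  unfolding order_preserving_def order_preserving_on_def by (auto simp: dom_def) fastforce

lemma order_preserving_iff_cut: "order_preserving \<alpha> \<longleftrightarrow> orientation_cut UNIV \<alpha>"
  unfolding order_preserving_iff orientation_cut_def by simp

lemma orientation_preserving_iff_cut:
  "orientation_preserving \<alpha> \<longleftrightarrow> (\<exists>Y. orientation_cut Y \<alpha>)"
proof
  assume "orientation_preserving \<alpha>"
  then consider "\<alpha> = Map.empty"
    | Y where "order_preserving_on Y \<alpha>" "order_preserving_on (dom \<alpha> - Y) \<alpha>"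
        "\<forall>a\<in>Y. \<forall>b\<in>dom \<alpha> - Y. a \<le> b \<and> the (\<alpha> a) \<ge> the (\<alpha> b)"
    unfolding orientation_preserving_def by blast
  then show "\<exists>Y. orientation_cut Y \<alpha>"
  proof cases
    case 1
    then show ?thesis by (simp add: orientation_cut_def)
  next
    case 2
    have "orientation_cut Y \<alpha>"
    proof (rule orientation_cutI)
      fix x y u v assume "\<alpha> x = Some u" "\<alpha> y = Some v" "x \<in> Y" "y \<notin> Y"
      with 2(3) show "x \<le> y \<and> v \<le> u" by force
    next
      fix x y u v assume "\<alpha> x = Some u" "\<alpha> y = Some v" "x \<in> Y \<longleftrightarrow> y \<in> Y" "x \<le> y"
      with 2(1,2) show "u \<le> v" unfolding order_preserving_on_def by (cases "x \<in> Y") force+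
    qed
    then show ?thesis by blast
  qed
next
  assume "\<exists>Y. orientation_cut Y \<alpha>"
  then obtain Y where Y: "orientation_cut Y \<alpha>" by blast
  \<comment> \<open>A cut whose lower part is empty says the same as the one whose upper part is empty, and
    the latter has a non-empty lower part unless \<open>\<alpha>\<close> is empty.\<close>
  define W where "W = (if Y \<inter> dom \<alpha> = {} then dom \<alpha> else Y \<inter> dom \<alpha>)"
  have mono: "the (\<alpha> x) \<le> the (\<alpha> y)"
    if "x \<in> dom \<alpha>" "y \<in> dom \<alpha>" "x \<in> Y \<longleftrightarrow> y \<in> Y" "x \<le> y" for x y
    using that orientation_cut_within[OF Y] by fastforce
  have across: "x \<le> y \<and> the (\<alpha> y) \<le> the (\<alpha> x)"
    if "x \<in> dom \<alpha>" "y \<in> dom \<alpha>" "x \<in> Y" "y \<notin> Y" for x y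
    using that orientation_cut_across[OF Y] by fastforce
  have sub: "W \<subseteq> dom \<alpha>"
    unfolding W_def by simp
  have same: "x \<in> Y \<longleftrightarrow> y \<in> Y" if "x \<in> dom \<alpha>" "y \<in> dom \<alpha>" "x \<in> W \<longleftrightarrow> y \<in> W" for x y
    using that unfolding W_def by (auto split: if_splits)
  have diff: "x \<in> Y \<and> y \<notin> Y" if "x \<in> W" "y \<in> dom \<alpha> - W" for x y
    using that unfolding W_def by (auto split: if_splits)
  have "order_preserving_on W \<alpha>" "order_preserving_on (dom \<alpha> - W) \<alpha>"
    unfolding order_preserving_on_def using sub same mono by blast+
  moreover have "\<forall>a\<in>W. \<forall>b\<in>dom \<alpha> - W. a \<le> b \<and> the (\<alpha> a) \<ge> the (\<alpha> b)"
    using sub across diff by blast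
  moreover have "W \<noteq> {}" if "\<alpha> \<noteq> Map.empty"
    using that unfolding W_def by simp
  ultimately show "orientation_preserving \<alpha>"
    unfolding orientation_preserving_def using sub by blast
qed

section \<open>Composition\<close>

lemma comp_order_preserving:
  assumes "order_preserving \<alpha>" "order_preserving \<beta>"
  shows "order_preserving (\<beta> \<circ>\<^sub>m \<alpha>)"
  using assms unfolding order_preserving_iff by (auto simp: map_comp_Some_iff)

text \<open>
  The block to end the lower part with depends on which of the two incompatible blocks is empty.
  If \<open>(Y, U)\<close> is, the three others appear in the order \<open>(Y, -U) < (-Y, U) < (-Y, -U)\<close> and the
  values descend before the last one.  If \<open>(-Y, -U)\<close> is, the order is
  \<open>(Y, U) < (Y, -U) < (-Y, U)\<close> and the values descend after the first one.
\<close>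
lemma comp_orientation_cut:
  assumes Y: "orientation_cut Y \<alpha>" and U: "orientation_cut U \<beta>"
  shows "\<exists>W. orientation_cut W (\<beta> \<circ>\<^sub>m \<alpha>)"
proof -
  define YU where "YU = {x \<in> Y. \<exists>u\<in>U \<inter> dom \<beta>. \<alpha> x = Some u}"
  define V where "V = {x. \<exists>u\<in>U. \<alpha> x = Some u}"
  \<comment> \<open>The cut conditions for both maps at two points of the domain of the composite. With the order
    across the two cuts made strict, the block argument is propositional from here.\<close>
  have step:
    "x \<in> Y \<Longrightarrow> y \<notin> Y \<Longrightarrow> x \<le> y \<and> \<not> y \<le> x \<and> v \<le> u"
    "y \<in> Y \<Longrightarrow> x \<notin> Y \<Longrightarrow> y \<le> x \<and> \<not> x \<le> y \<and> u \<le> v"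
    "(x \<in> Y \<longleftrightarrow> y \<in> Y) \<Longrightarrow> x \<le> y \<Longrightarrow> u \<le> v"
    "(x \<in> Y \<longleftrightarrow> y \<in> Y) \<Longrightarrow> \<not> x \<le> y \<Longrightarrow> v \<le> u"
    "u \<in> U \<Longrightarrow> v \<notin> U \<Longrightarrow> \<not> v \<le> u \<and> q \<le> p"
    "v \<in> U \<Longrightarrow> u \<notin> U \<Longrightarrow> \<not> u \<le> v \<and> p \<le> q"
    "(u \<in> U \<longleftrightarrow> v \<in> U) \<Longrightarrow> u \<le> v \<Longrightarrow> p \<le> q"
    "(u \<in> U \<longleftrightarrow> v \<in> U) \<Longrightarrow> v \<le> u \<Longrightarrow> q \<le> p"
    if a: "\<alpha> x = Some u" "\<beta> u = Some p" "\<alpha> y = Some v" "\<beta> v = Some q" for x y u v p q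
    using orientation_cut_across[OF Y a(1,3)] orientation_cut_across[OF Y a(3,1)]
      orientation_cut_within[OF Y a(1,3)] orientation_cut_within[OF Y a(3,1)]
      orientation_cut_across[OF U a(2,4)] orientation_cut_across[OF U a(4,2)]
      orientation_cut_within[OF U a(2,4)] orientation_cut_within[OF U a(4,2)]
    by (auto dest: order_antisym)
  show ?thesis
  proof (cases "YU = {}")
    case True
    have "orientation_cut (Y \<union> V) (\<beta> \<circ>\<^sub>m \<alpha>)"
    proof (rule orientation_cutI)
      fix x y p q
      assume "(\<beta> \<circ>\<^sub>m \<alpha>) x = Some p" "(\<beta> \<circ>\<^sub>m \<alpha>) y = Some q"
      then obtain u v where a: "\<alpha> x = Some u" "\<beta> u = Some p" "\<alpha> y = Some v" "\<beta> v = Some q"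
        by (auto simp: map_comp_Some_iff)
      note facts = step[OF a]
      have n: "\<not> (x \<in> Y \<and> u \<in> U)" "\<not> (y \<in> Y \<and> v \<in> U)"
        using True a unfolding YU_def by auto
      have m: "x \<in> Y \<union> V \<longleftrightarrow> x \<in> Y \<or> u \<in> U" "y \<in> Y \<union> V \<longleftrightarrow> y \<in> Y \<or> v \<in> U"
        using a unfolding V_def by auto
      show "x \<le> y \<and> q \<le> p" if "x \<in> Y \<union> V" "y \<notin> Y \<union> V"
        using that[unfolded m] n facts by argo
      show "p \<le> q" if "x \<in> Y \<union> V \<longleftrightarrow> y \<in> Y \<union> V" "x \<le> y"
        using that[unfolded m] n facts by argo
    qed
    then show ?thesis by blast
  next
    case False
    then obtain z w r where z: "z \<in> Y" "w \<in> U" "\<alpha> z = Some w" "\<beta> w = Some r"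
      unfolding YU_def by blast
    have n: "x \<in> Y \<or> u \<in> U" if "\<alpha> x = Some u" "\<beta> u = Some p" for x u p
      using z(1,2) step[OF z(3,4) that] by argo
    have "orientation_cut YU (\<beta> \<circ>\<^sub>m \<alpha>)"
    proof (rule orientation_cutI)
      fix x y p q
      assume "(\<beta> \<circ>\<^sub>m \<alpha>) x = Some p" "(\<beta> \<circ>\<^sub>m \<alpha>) y = Some q"
      then obtain u v where a: "\<alpha> x = Some u" "\<beta> u = Some p" "\<alpha> y = Some v" "\<beta> v = Some q"
        by (auto simp: map_comp_Some_iff)
      note facts = step[OF a] n[OF a(1,2)] n[OF a(3,4)]
      have m: "x \<in> YU \<longleftrightarrow> x \<in> Y \<and> u \<in> U" "y \<in> YU \<longleftrightarrow> y \<in> Y \<and> v \<in> U"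
        using a unfolding YU_def by auto
      show "x \<le> y \<and> q \<le> p" if "x \<in> YU" "y \<notin> YU"
        using that[unfolded m] facts by argo
      show "p \<le> q" if "x \<in> YU \<longleftrightarrow> y \<in> YU" "x \<le> y"
        using that[unfolded m] facts by argo
    qed
    then show ?thesis by blast
  qed
qed

section \<open>Inverses\<close>

text \<open>
  The preference for \<open>Y\<close> matters only for a value shared by the two parts: without it, the
  choice could fall on either side of the cut, and the set of values with preimage chosen
  in \<open>Y\<close> would depend on \<open>SOME\<close>.
\<close>
definition preimage_choice :: "'a set \<Rightarrow> ('a \<rightharpoonup> 'a) \<Rightarrow> ('a \<rightharpoonup> 'a)" where
  "preimage_choice Y \<alpha> = (\<lambda>v.
     if v \<in> ran \<alpha>
     then Some (SOME x. \<alpha> x = Some v \<and> (x \<in> Y \<or> (\<forall>z\<in>Y. \<alpha> z \<noteq> Some v)))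
     else None)"

lemma dom_preimage_choice: "dom (preimage_choice Y \<alpha>) = ran \<alpha>"
  unfolding preimage_choice_def by (auto split: if_splits)

lemma preimage_choice_SomeD:
  assumes "preimage_choice Y \<alpha> v = Some x"
  shows "\<alpha> x = Some v" "x \<in> Y \<longleftrightarrow> Some v \<in> \<alpha> ` Y"
proof -
  have v: "v \<in> ran \<alpha>" and x: "x = (SOME x. \<alpha> x = Some v \<and> (x \<in> Y \<or> (\<forall>z\<in>Y. \<alpha> z \<noteq> Some v)))"
    using assms unfolding preimage_choice_def by (auto split: if_splits)
  have "\<exists>x. \<alpha> x = Some v \<and> (x \<in> Y \<or> (\<forall>z\<in>Y. \<alpha> z \<noteq> Some v))"
    using v unfolding ran_def by blast
  then have "\<alpha> x = Some v \<and> (x \<in> Y \<or> (\<forall>z\<in>Y. \<alpha> z \<noteq> Some v))"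
    unfolding x by (rule someI_ex)
  then show "\<alpha> x = Some v" "x \<in> Y \<longleftrightarrow> Some v \<in> \<alpha> ` Y"
    by (auto simp: image_iff) metis
qed

lemma ran_preimage_choice: "ran (preimage_choice Y \<alpha>) \<subseteq> dom \<alpha>"
  using preimage_choice_SomeD(1) unfolding ran_def by fastforce

lemma comp_preimage_choice: "\<alpha> \<circ>\<^sub>m (preimage_choice Y \<alpha> \<circ>\<^sub>m \<alpha>) = \<alpha>"
proof
  fix x
  show "(\<alpha> \<circ>\<^sub>m (preimage_choice Y \<alpha> \<circ>\<^sub>m \<alpha>)) x = \<alpha> x"
  proof (cases "\<alpha> x")
    case (Some v)
    then have "v \<in> dom (preimage_choice Y \<alpha>)"
      by (auto simp: dom_preimage_choice ran_def)
    then obtain z where "preimage_choice Y \<alpha> v = Some z" by blast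
    moreover from this have "\<alpha> z = Some v" by (rule preimage_choice_SomeD(1))
    ultimately show ?thesis using Some by (simp add: map_comp_def)
  qed (simp add: map_comp_def)
qed

text \<open>
  Values in the lower part of the new cut are attained only outside \<open>Y\<close>, hence lie below the others
  and have their chosen preimages above the others.  Within a part, the chosen preimages belong to
  the same part of \<open>\<alpha>\<close>; there a strict descent of preimages forces a descent of values, so two
  values in increasing order whose preimages strictly descend are equal, which is absurd.
\<close>
lemma inverse_orientation_cut:
  assumes Y: "orientation_cut Y \<alpha>"
  shows "orientation_cut {v. Some v \<notin> \<alpha> ` Y} (preimage_choice Y \<alpha>)"
proof (rule orientation_cutI)
  fix u v x y
  assume xy: "preimage_choice Y \<alpha> u = Some x" "preimage_choice Y \<alpha> v = Some y"
  note a = preimage_choice_SomeD[OF xy(1)] preimage_choice_SomeD[OF xy(2)]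
  show "u \<le> v \<and> y \<le> x" if "u \<in> {v. Some v \<notin> \<alpha> ` Y}" "v \<notin> {v. Some v \<notin> \<alpha> ` Y}"
    using that a orientation_cut_across[OF Y a(3) a(1)] by auto
  show "x \<le> y" if "u \<in> {v. Some v \<notin> \<alpha> ` Y} \<longleftrightarrow> v \<in> {v. Some v \<notin> \<alpha> ` Y}" "u \<le> v"
  proof (rule ccontr)
    assume "\<not> x \<le> y"
    then have "y \<le> x" by simp
    then have "v \<le> u"
      using that a orientation_cut_within[OF Y a(3) a(1)] by auto
    with \<open>u \<le> v\<close> have "u = v" by simp
    with xy \<open>\<not> x \<le> y\<close> show False by simp
  qed
qed

lemma order_preserving_preimage_choice:
  assumes "order_preserving \<alpha>"
  shows "order_preserving (preimage_choice UNIV \<alpha>)"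
proof -
  have cut: "orientation_cut {v. Some v \<notin> range \<alpha>} (preimage_choice UNIV \<alpha>)"
    using assms unfolding order_preserving_iff_cut by (rule inverse_orientation_cut)
  have attained: "Some v \<in> range \<alpha>" if "preimage_choice UNIV \<alpha> v = Some x" for v x
    using preimage_choice_SomeD(2)[OF that] by simp
  show ?thesis
    unfolding order_preserving_iff
  proof (intro allI impI)
    fix u v x y
    assume xy: "preimage_choice UNIV \<alpha> u = Some x" "preimage_choice UNIV \<alpha> v = Some y"
      and "u \<le> v"
    then show "x \<le> y"
      using orientation_cut_within[OF cut xy] attained[OF xy(1)] attained[OF xy(2)] by simp
  qed
qed

section \<open>Regular monoids of partial transformations\<close>

lemma map_comp_in_PT:
  assumes "\<alpha> \<in> carrier (PT X)" "\<beta> \<in> carrier (PT X)"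
  shows "\<beta> \<circ>\<^sub>m \<alpha> \<in> carrier (PT X)"
proof -
  have "dom (\<beta> \<circ>\<^sub>m \<alpha>) \<subseteq> dom \<alpha>" "ran (\<beta> \<circ>\<^sub>m \<alpha>) \<subseteq> ran \<beta>"
    by (auto simp: dom_def ran_def map_comp_Some_iff)
  with assms show ?thesis unfolding PT_def by auto
qed

lemma preimage_choice_in_PT:
  assumes "\<alpha> \<in> carrier (PT X)"
  shows "preimage_choice Y \<alpha> \<in> carrier (PT X)"
  using assms dom_preimage_choice[of Y \<alpha>] ran_preimage_choice[of Y \<alpha>] unfolding PT_def by auto

lemma map_comp_assoc: "\<gamma> \<circ>\<^sub>m (\<beta> \<circ>\<^sub>m \<alpha>) = (\<gamma> \<circ>\<^sub>m \<beta>) \<circ>\<^sub>m \<alpha>"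
  by (rule ext) (simp add: map_comp_def split: option.split)

lemma map_comp_restricted_id_left: "ran \<alpha> \<subseteq> X \<Longrightarrow> (Some |` X) \<circ>\<^sub>m \<alpha> = \<alpha>"
  by (rule ext) (auto simp: map_comp_def restrict_map_def ran_def split: option.split)

lemma map_comp_restricted_id_right:
  assumes "dom \<alpha> \<subseteq> X"
  shows "\<alpha> \<circ>\<^sub>m (Some |` X) = \<alpha>"
proof
  fix x
  have "x \<notin> dom \<alpha>" if "x \<notin> X"
    using that assms by blast
  then show "(\<alpha> \<circ>\<^sub>m (Some |` X)) x = \<alpha> x"
    by (cases "x \<in> X") (simp_all add: map_comp_def domIff)
qed

text \<open>
  A common frame for the two monoids.  Preimage choices always satisfy \<open>\<alpha>\<beta>\<alpha> = \<alpha>\<close>, so regularity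
  only asks that one of them stays inside the submonoid.
\<close>
lemma regular_submonoid_PT:
  assumes one: "P (Some |` X)"
    and comp: "\<And>\<alpha> \<beta>. P \<alpha> \<Longrightarrow> P \<beta> \<Longrightarrow> P (\<beta> \<circ>\<^sub>m \<alpha>)"
    and inverse: "\<And>\<alpha>. P \<alpha> \<Longrightarrow> \<exists>Y. P (preimage_choice Y \<alpha>)"
  shows "regular_monoid ((PT X)\<lparr>carrier := {\<alpha> \<in> carrier (PT X). P \<alpha>}\<rparr>)" (is "regular_monoid ?S")
proof -
  have mult: "\<alpha> \<otimes>\<^bsub>?S\<^esub> \<beta> = \<beta> \<circ>\<^sub>m \<alpha>" for \<alpha> \<beta>
    by (simp add: PT_def)
  have carrier: "\<alpha> \<in> carrier ?S \<longleftrightarrow> \<alpha> \<in> carrier (PT X) \<and> P \<alpha>" for \<alpha>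
    by simp
  have bounds: "dom \<alpha> \<subseteq> X" "ran \<alpha> \<subseteq> X" if "\<alpha> \<in> carrier ?S" for \<alpha>
    using that by (auto simp: PT_def)
  have one_eq: "\<one>\<^bsub>?S\<^esub> = Some |` X"
    by (simp add: PT_def)
  have "Some |` X \<in> carrier (PT X)"
    by (auto simp: PT_def restrict_map_def ran_def split: if_splits)
  with one have one_in: "\<one>\<^bsub>?S\<^esub> \<in> carrier ?S"
    unfolding carrier one_eq by blast
  interpret monoid ?S
  proof (rule monoidI)
    show "\<alpha> \<otimes>\<^bsub>?S\<^esub> \<beta> \<in> carrier ?S" if "\<alpha> \<in> carrier ?S" "\<beta> \<in> carrier ?S" for \<alpha> \<beta>
      using that comp map_comp_in_PT unfolding carrier mult by blast
    show "\<alpha> \<otimes>\<^bsub>?S\<^esub> \<beta> \<otimes>\<^bsub>?S\<^esub> \<gamma> = \<alpha> \<otimes>\<^bsub>?S\<^esub> (\<beta> \<otimes>\<^bsub>?S\<^esub> \<gamma>)" for \<alpha> \<beta> \<gamma>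
      unfolding mult by (rule map_comp_assoc)
    show "\<one>\<^bsub>?S\<^esub> \<otimes>\<^bsub>?S\<^esub> \<alpha> = \<alpha>" if "\<alpha> \<in> carrier ?S" for \<alpha>
      unfolding mult one_eq by (rule map_comp_restricted_id_right) (rule bounds(1)[OF that])
    show "\<alpha> \<otimes>\<^bsub>?S\<^esub> \<one>\<^bsub>?S\<^esub> = \<alpha>" if "\<alpha> \<in> carrier ?S" for \<alpha>
      unfolding mult one_eq by (rule map_comp_restricted_id_left) (rule bounds(2)[OF that])
  qed (rule one_in)
  show ?thesis
  proof
    fix \<alpha> assume \<alpha>: "\<alpha> \<in> carrier ?S"
    then obtain Y where "P (preimage_choice Y \<alpha>)"
      using inverse unfolding carrier by blast
    with \<alpha> have "preimage_choice Y \<alpha> \<in> carrier ?S"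
      using preimage_choice_in_PT unfolding carrier by blast
    moreover have "\<alpha> = \<alpha> \<otimes>\<^bsub>?S\<^esub> preimage_choice Y \<alpha> \<otimes>\<^bsub>?S\<^esub> \<alpha>"
      unfolding mult by (simp only: comp_preimage_choice)
    ultimately show "\<exists>\<beta>\<in>carrier ?S. \<alpha> = \<alpha> \<otimes>\<^bsub>?S\<^esub> \<beta> \<otimes>\<^bsub>?S\<^esub> \<alpha>" by blast
  qed
qed

lemma order_preserving_restricted_id: "order_preserving (Some |` X)"
  unfolding order_preserving_iff by (auto simp: restrict_map_def split: if_splits)

theorem theorem2p5:
  fixes X :: "'a::linorder set"
  shows "regular_monoid (PO X) \<and> regular_monoid (POP X)"
proof
  show "regular_monoid (PO X)"
    unfolding PO_def
  proof (rule regular_submonoid_PT)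
    show "order_preserving (Some |` X)"
      by (rule order_preserving_restricted_id)
    show "order_preserving (\<beta> \<circ>\<^sub>m \<alpha>)" if "order_preserving \<alpha>" "order_preserving \<beta>"
      for \<alpha> \<beta> :: "'a \<rightharpoonup> 'a"
      using that by (rule comp_order_preserving)
    show "\<exists>Y. order_preserving (preimage_choice Y \<alpha>)" if "order_preserving \<alpha>"
      for \<alpha> :: "'a \<rightharpoonup> 'a"
      using order_preserving_preimage_choice[OF that] by blast
  qed
  show "regular_monoid (POP X)"
    unfolding POP_def
  proof (rule regular_submonoid_PT)
    show "orientation_preserving (Some |` X)"
      using order_preserving_restricted_id[of X]
      unfolding order_preserving_iff_cut orientation_preserving_iff_cut by blast
    show "orientation_preserving (\<beta> \<circ>\<^sub>m \<alpha>)"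
      if "orientation_preserving \<alpha>" "orientation_preserving \<beta>" for \<alpha> \<beta> :: "'a \<rightharpoonup> 'a"
      using that comp_orientation_cut unfolding orientation_preserving_iff_cut by blast
    show "\<exists>Y. orientation_preserving (preimage_choice Y \<alpha>)" if "orientation_preserving \<alpha>"
      for \<alpha> :: "'a \<rightharpoonup> 'a"
      using that inverse_orientation_cut unfolding orientation_preserving_iff_cut by blast
  qed
qed

end
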